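(* Suppose the bilevel problem has a local real optimistic solution. (I) If there exists at least one local real optimistic solution $x^0$ of the bilevel problem such that there is $y^0\in\psi(x^0)$ with $F_o(x^0)=F(x^0,y^0)$, then $x^0$ is a local $l$-minimal solution of the set-valued formulation. (II) If no local real optimistic solution $x$ of the bilevel problem has a $y\in\psi(x)$ with $F_o(x)=F(x,y)$, then every local real optimistic solution of the bilevel problem is also a local $l$-minimal solution of the set-valued formulation.
   Context: Setting. $\mathcal{X},\mathcal{Y}$ are real normed linear spaces, $X\subseteq\mathcal{X}$ is nonempty, $F:\mathcal{X}\times\mathcal{Y}\to\mathbb{R}$ is the upper-level objective. For each $x\in X$, $K(x)\subseteq\mathcal{Y}$ is the lower-level constraint set, $f$ is the real-valued lower-level objective, and $\psi(x)=\arg\min_y\{f(x,y)\mid y\in K(x)\}$ is the set of global minimizers of $f(x,\cdot)$ over $K(x)$. Standing assumption: $\psi(x)\neq\emptyset$ for every $x\in X$. The bilevel problem is: "minimize" over $x$ the value $F(x,y)$ subject to $x\in X$, $y\in\psi(x)$. $F_o(x)=\inf_{y\in\psi(x)}F(x,y)$ for $x\in X$ (possibly $-\infty$; attainment is not assumed). A point $x^*\in X$ is a local real optimistic solution of the bilevel problem if there is $\epsilon>0$ such that $F_o(x)\ge F_o(x^* )$ for all $x\in X$ with $\|x-x^*\|<\epsilon$. Set-valued formulation: minimize $F(x,\psi(x))$ over $x\in X$, where $F(x,\psi(x)):=\{F(x,y)\mid y\in\psi(x)\}\subseteq\mathbb{R}$. $\mathbb{R}$ carries its usual order, induced by the cone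 $C=\mathbb{R}_+=[0,\infty)$. For nonempty $A,B\subseteq\mathbb{R}$, $A\le_C^l B$ means $B\subseteq A+C$. A point $x^0\in X$ is a local $l$-minimal solution of the set-valued formulation if there is $\epsilon>0$ such that for every $x\in X$ with $\|x-x^0\|<\epsilon$ and $F(x,\psi(x))\le_C^l F(x^0,\psi(x^0))$ one has $F(x^0,\psi(x^0))\le_C^l F(x,\psi(x))$. *)

theory Defs
  imports Complex_Main "HOL-Library.Extended_Real" "HOL-Library.Set_Algebras"
begin

definition lower_sol :: "('x \<Rightarrow> 'y \<Rightarrow> real) \<Rightarrow> ('x \<Rightarrow> 'y set) \<Rightarrow> 'x \<Rightarrow> 'y set" where
  "lower_sol f K x = {y. is_arg_min (f x) (\<lambda>z. z \<in> K x) y}"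

(* The infimum is taken in the extended reals, so that it may be -\<infinity>
   and need not be attained. *)
definition opt_value :: "('x \<Rightarrow> 'y \<Rightarrow> real) \<Rightarrow> ('x \<Rightarrow> 'y set) \<Rightarrow> 'x \<Rightarrow> ereal" where
  "opt_value F \<psi> x = (INF y\<in>\<psi> x. ereal (F x y))"

definition local_real_optimistic ::
  "'x::real_normed_vector set \<Rightarrow> ('x \<Rightarrow> 'y \<Rightarrow> real) \<Rightarrow> ('x \<Rightarrow> 'y set) \<Rightarrow> 'x \<Rightarrow> bool" where
  "local_real_optimistic X F \<psi> xs \<longleftrightarrow>
     xs \<in> X \<and>
     (\<exists>\<epsilon>>0. \<forall>x\<in>X. norm (x - xs) < \<epsilon> \<longrightarrow> opt_value F \<psi> x \<ge> opt_value F \<psi> xs)"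

(* Here + is the Minkowski sum of sets. *)
definition l_le :: "'z::plus set \<Rightarrow> 'z set \<Rightarrow> 'z set \<Rightarrow> bool" where
  "l_le C A B \<longleftrightarrow> B \<subseteq> A + C"

definition local_l_minimal ::
  "'z::plus set \<Rightarrow> 'x::real_normed_vector set \<Rightarrow> ('x \<Rightarrow> 'z set) \<Rightarrow> 'x \<Rightarrow> bool" where
  "local_l_minimal C X G x0 \<longleftrightarrow>
     x0 \<in> X \<and>
     (\<exists>\<epsilon>>0. \<forall>x\<in>X. norm (x - x0) < \<epsilon> \<and> l_le C (G x) (G x0) \<longrightarrow> l_le C (G x0) (G x))"

end

theory Submission
  imports Defs
begin

text \<open>
  On the real line the lower set order sees little more than the infimum: \<open>A\<close> precedes \<open>B\<close> forces
  \<open>inf A \<le> inf B\<close>, and the converse can only fail when the two infima agree, \<open>B\<close> attains this common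
  value and \<open>A\<close> does not (\<open>l_le_if_opt_value_le\<close>). Around a local optimistic solution \<open>x\<^sup>0\<close> the
  infima satisfy \<open>F\<^sub>o(x\<^sup>0) \<le> F\<^sub>o(x)\<close>, so this exceptional situation is all that has to be excluded.

  If \<open>F\<^sub>o(x\<^sup>0)\<close> is attained, it is excluded at once. If no local optimistic solution attains its
  value, consider a nearby \<open>x\<close> whose image set precedes that of \<open>x\<^sup>0\<close>. Then \<open>F\<^sub>o(x) = F\<^sub>o(x\<^sup>0)\<close>, so
  \<open>x\<close> minimizes \<open>F\<^sub>o\<close> over the same neighbourhood of \<open>x\<^sup>0\<close> and is itself a local optimistic solution
  (\<open>local_real_optimistic_if_opt_value_eq\<close>). Hence \<open>F\<^sub>o(x)\<close> is not attained, which again excludes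
  the exceptional situation. Infima equal to \<open>-\<infinity>\<close> need no separate treatment, since they are
  never attained by real values.
\<close>

lemma l_le_atLeast_0_iff:
  fixes A B :: "'z::linordered_idom set"
  shows "l_le {0..} A B \<longleftrightarrow> (\<forall>b\<in>B. \<exists>a\<in>A. a \<le> b)"
proof
  assume le: "l_le {0..} A B"
  show "\<forall>b\<in>B. \<exists>a\<in>A. a \<le> b"
  proof
    fix b assume "b \<in> B"
    with le have "b \<in> A + {0..}" unfolding l_le_def by blast
    then obtain a c where "b = a + c" "a \<in> A" "c \<in> {0..}"
      by (rule set_plus_elim)
    then show "\<exists>a\<in>A. a \<le> b" by (intro bexI[of _ a]) auto
  qed
next
  assume dominated: "\<forall>b\<in>B. \<exists>a\<in>A. a \<le> b"
  show "l_le {0..} A B"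
    unfolding l_le_def
  proof
    fix b assume "b \<in> B"
    with dominated obtain a where "a \<in> A" "a \<le> b" by blast
    then have "a + (b - a) \<in> A + {0..}"
      by (intro set_plus_intro) auto
    then show "b \<in> A + {0..}" by simp
  qed
qed

lemma opt_value_le_if_l_le:
  assumes "l_le {0..} (F u ` \<psi> u) (F v ` \<psi> v)"
  shows "opt_value F \<psi> u \<le> opt_value F \<psi> v"
  using assms unfolding opt_value_def l_le_atLeast_0_iff
  by (intro INF_mono) auto

text \<open>
  A value \<open>b\<close> over \<open>v\<close> lying strictly above the infimum over \<open>u\<close> is dominated by some value over
  \<open>u\<close>, by the definition of an infimum. Otherwise \<open>b\<close> equals both infima, so it is attained over
  \<open>v\<close>, and domination requires that it be attained over \<open>u\<close> as well.
\<close>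

lemma l_le_if_opt_value_le:
  assumes le: "opt_value F \<psi> u \<le> opt_value F \<psi> v"
    and attained: "(\<exists>y\<in>\<psi> v. opt_value F \<psi> v = ereal (F v y))
      \<Longrightarrow> \<exists>y\<in>\<psi> u. opt_value F \<psi> u = ereal (F u y)"
  shows "l_le {0..} (F u ` \<psi> u) (F v ` \<psi> v)"
  unfolding l_le_atLeast_0_iff
proof
  fix b assume "b \<in> F v ` \<psi> v"
  then obtain y where y: "y \<in> \<psi> v" "b = F v y" by blast
  then have v_le: "opt_value F \<psi> v \<le> ereal b"
    unfolding opt_value_def by (auto intro: INF_lower)
  show "\<exists>a\<in>F u ` \<psi> u. a \<le> b"
  proof (cases "opt_value F \<psi> u < ereal b")
    case True
    then obtain z where "z \<in> \<psi> u" "ereal (F u z) < ereal b"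
      unfolding opt_value_def INF_less_iff by blast
    then show ?thesis by force
  next
    case False
    with le v_le have "opt_value F \<psi> v = ereal b" "opt_value F \<psi> u = ereal b"
      by auto
    with attained y obtain z where "z \<in> \<psi> u" "ereal (F u z) = ereal b"
      by metis
    then show ?thesis by force
  qed
qed

text \<open>
  A ball around a local minimizer contains a smaller ball around each of its points, so a feasible
  point of that ball with the same value of \<open>F\<^sub>o\<close> inherits local optimality.
\<close>

lemma local_real_optimistic_if_opt_value_eq:
  assumes min: "\<forall>z\<in>X. norm (z - x0) < \<epsilon> \<longrightarrow> opt_value F \<psi> z \<ge> opt_value F \<psi> x0"
    and x: "x \<in> X" "norm (x - x0) < \<epsilon>" "opt_value F \<psi> x = opt_value F \<psi> x0"
  shows "local_real_optimistic X F \<psi> x"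
proof -
  have "opt_value F \<psi> z \<ge> opt_value F \<psi> x"
    if "z \<in> X" "norm (z - x) < \<epsilon> - norm (x - x0)" for z
  proof -
    have "norm (z - x0) \<le> norm (z - x) + norm (x - x0)"
      using norm_triangle_ineq[of "z - x" "x - x0"] by simp
    with that have "norm (z - x0) < \<epsilon>" by simp
    with min x that show ?thesis by simp
  qed
  moreover have "\<epsilon> - norm (x - x0) > 0" using x by simp
  ultimately show ?thesis
    using x unfolding local_real_optimistic_def by blast
qed

text \<open>
  The common core of both claims: attainment of \<open>F\<^sub>o\<close> only has to be transferred from local
  optimistic solutions \<open>x\<close> to \<open>x\<^sup>0\<close>. This holds trivially if \<open>x\<^sup>0\<close> attains its value, and vacuously if
  no local optimistic solution does.
\<close>

lemma local_l_minimal_if_local_real_optimistic: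
  assumes opt: "local_real_optimistic X F \<psi> x0"
    and attained: "\<And>x. \<lbrakk>local_real_optimistic X F \<psi> x; \<exists>y\<in>\<psi> x. opt_value F \<psi> x = ereal (F x y)\<rbrakk>
      \<Longrightarrow> \<exists>y\<in>\<psi> x0. opt_value F \<psi> x0 = ereal (F x0 y)"
  shows "local_l_minimal {0..} X (\<lambda>x. F x ` \<psi> x) x0"
proof -
  from opt obtain \<epsilon> where x0: "x0 \<in> X" and "\<epsilon> > 0"
    and min: "\<forall>x\<in>X. norm (x - x0) < \<epsilon> \<longrightarrow> opt_value F \<psi> x \<ge> opt_value F \<psi> x0"
    unfolding local_real_optimistic_def by blast
  have "l_le {0..} (F x0 ` \<psi> x0) (F x ` \<psi> x)"
    if x: "x \<in> X" "norm (x - x0) < \<epsilon>" and le: "l_le {0..} (F x ` \<psi> x) (F x0 ` \<psi> x0)" for x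
  proof -
    have eq: "opt_value F \<psi> x = opt_value F \<psi> x0"
      using opt_value_le_if_l_le[OF le] min x by (simp add: order_antisym)
    then have "local_real_optimistic X F \<psi> x"
      using local_real_optimistic_if_opt_value_eq[OF min x] by simp
    from attained[OF this] eq show ?thesis
      by (intro l_le_if_opt_value_le) simp_all
  qed
  with x0 \<open>\<epsilon> > 0\<close> show ?thesis
    unfolding local_l_minimal_def by blast
qed

theorem theorem14:
  fixes X :: "'x::real_normed_vector set"
    and K :: "'x \<Rightarrow> 'y::real_normed_vector set"
    and F f :: "'x \<Rightarrow> 'y \<Rightarrow> real"
    and \<psi> :: "'x \<Rightarrow> 'y set"
  defines "\<psi> \<equiv> lower_sol f K"
  assumes "X \<noteq> {}"
    and "\<forall>x\<in>X. \<psi> x \<noteq> {}"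
    and "\<exists>x. local_real_optimistic X F \<psi> x"
  shows "(\<forall>x0. local_real_optimistic X F \<psi> x0 \<and> (\<exists>y0\<in>\<psi> x0. opt_value F \<psi> x0 = ereal (F x0 y0))
            \<longrightarrow> local_l_minimal {0::real..} X (\<lambda>x. F x ` \<psi> x) x0)
       \<and> ((\<nexists>x. local_real_optimistic X F \<psi> x \<and> (\<exists>y\<in>\<psi> x. opt_value F \<psi> x = ereal (F x y)))
            \<longrightarrow> (\<forall>x. local_real_optimistic X F \<psi> x
                   \<longrightarrow> local_l_minimal {0::real..} X (\<lambda>x. F x ` \<psi> x) x))"
  by (blast intro: local_l_minimal_if_local_real_optimistic)

end
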